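(* If $H^\ast_G(P;z)$ is polynomial, then $H^\ast_{\mathcal H}(P;z)$ is polynomial.
   Context: Let $G$ be a finite group acting linearly on a lattice $M' \cong M \times \mathbb{Z}$ of rank $d+1$ such that the $\mathbb{Z}$-coordinate of lattice points is preserved by the action, via a representation $\rho: G \to \operatorname{GL}(M')$. Let $P \subset M'_{\mathbb{R}} = M'\otimes_{\mathbb{Z}}\mathbb{R}$ be a $d$-dimensional $G$-invariant polytope (i.e. $g(P)=P$ for all $g\in G$) with vertices in $M \times \{1\}$. For $t \ge 0$ let $\chi_{tP}$ be the complex permutation character of the action of $G$ on the lattice points $tP \cap M'$. The equivariant Ehrhart series is $\sum_{t\ge 0}\chi_{tP}z^t = \frac{H^\ast(P;z)}{\det(I - z\cdot\rho)}$, where $H^\ast(P;z)$ is a formal power series with coefficients in the character ring $R(G)$ (integer linear combinations of irreducible characters of $G$). Let $\mathcal H$ be a subgroup of $G$; the action of $G$ on $P$ induces an action of $\mathcal H$ by restriction. Let $H^\ast_G(P;z)$ and $H^\ast_{\mathcal H}(P;z)$ denote the $H^\ast$-series of $P$ with respect to the actions of $G$ and $\mathcal H$, respectively. *)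

theory Defs
  imports
    "HOL-Analysis.Analysis"
    "HOL-Algebra.Group"
    "HOL-Computational_Algebra.Polynomial_FPS"
    "HOL-Library.Function_Algebras"
    "Jordan_Normal_Form.VS_Connect"
begin

no_notation Matrix.vec_index (infixl "$" 100)

section \<open>The character ring of a finite group\<close>

text \<open>
  A complex matrix representation of degree n. The degree has to vary inside the definition of the
  character ring, so these are matrices with explicit dimensions (type \<open>complex mat\<close>).
\<close>

definition complex_rep ::
    "('g, 'b) monoid_scheme \<Rightarrow> nat \<Rightarrow> ('g \<Rightarrow> complex mat) \<Rightarrow> bool" where
  "complex_rep G n \<sigma> \<longleftrightarrow>
     (\<forall>g\<in>carrier G. \<sigma> g \<in> carrier_mat n n) \<and>
     \<sigma> \<one>\<^bsub>G\<^esub> = 1\<^sub>m n \<and>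
     (\<forall>g\<in>carrier G. \<forall>h\<in>carrier G. \<sigma> (g \<otimes>\<^bsub>G\<^esub> h) = \<sigma> g * \<sigma> h)"

definition irreducible_rep ::
    "('g, 'b) monoid_scheme \<Rightarrow> nat \<Rightarrow> ('g \<Rightarrow> complex mat) \<Rightarrow> bool" where
  "irreducible_rep G n \<sigma> \<longleftrightarrow>
     complex_rep G n \<sigma> \<and> n > 0 \<and>
     (\<forall>W. VectorSpace.subspace class_ring W (module_vec TYPE(complex) n) \<and>
          (\<forall>g\<in>carrier G. \<forall>w\<in>W. \<sigma> g *\<^sub>v w \<in> W)
        \<longrightarrow> W = {0\<^sub>v n} \<or> W = carrier_vec n)"

text \<open>
  Class functions are functions on the whole type \<open>'g\<close> that vanish outside the carrier, so that
  equality of functions is equality on the group.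
\<close>

definition rep_character ::
    "('g, 'b) monoid_scheme \<Rightarrow> nat \<Rightarrow> ('g \<Rightarrow> complex mat) \<Rightarrow> 'g \<Rightarrow> complex" where
  "rep_character G n \<sigma> = (\<lambda>g. if g \<in> carrier G then \<Sum>i<n. \<sigma> g $$ (i, i) else 0)"

definition irreducible_characters ::
    "('g, 'b) monoid_scheme \<Rightarrow> ('g \<Rightarrow> complex) set" where
  "irreducible_characters G = {rep_character G n \<sigma> | n \<sigma>. irreducible_rep G n \<sigma>}"

definition character_ring ::
    "('g, 'b) monoid_scheme \<Rightarrow> ('g \<Rightarrow> complex) set" where
  "character_ring G =
     {(\<lambda>g. \<Sum>\<psi>\<in>S. of_int (a \<psi>) * \<psi> g) | S (a :: _ \<Rightarrow> int).
        finite S \<and> S \<subseteq> irreducible_characters G}"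

section \<open>Lattices and equivariant Ehrhart theory\<close>

text \<open>
  The lattice \<open>M' = M \<times> \<int>\<close> of rank d + 1 is \<open>int ^ 'm\<close> with \<open>CARD('m) = d + 1\<close>; a distinguished
  index \<open>c :: 'm\<close> plays the role of the \<open>\<int>\<close>-coordinate. This includes the case d = 0.
  Inside \<open>M' \<otimes> \<real> = real ^ 'm\<close> the lattice consists of the integral vectors.
\<close>

definition lattice_GL :: "(int ^ 'm ^ 'm) monoid" where
  "lattice_GL =
     \<lparr>carrier = {A. invertible A},
      monoid.mult = (**), one = Finite_Cartesian_Product.mat 1\<rparr>"

definition lattice_points :: "(real ^ 'm) set" where
  "lattice_points = {x. \<forall>i. x $ i \<in> \<int>}"

definition real_action :: "int ^ 'm ^ 'm \<Rightarrow> real ^ 'm \<Rightarrow> real ^ 'm" where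
  "real_action A x = map_matrix real_of_int A *v x"

text \<open>
  The character of the permutation representation of \<open>G\<close> on the lattice points of \<open>tP\<close>: the trace
  of a permutation matrix is the number of fixed points.
\<close>

definition ehrhart_character ::
    "('g, 'b) monoid_scheme \<Rightarrow> ('g \<Rightarrow> int ^ 'm ^ 'm) \<Rightarrow> (real ^ 'm) set \<Rightarrow> nat \<Rightarrow> 'g \<Rightarrow> complex" where
  "ehrhart_character G \<rho> P t = (\<lambda>g.
     if g \<in> carrier G
     then of_nat (card {x \<in> (\<lambda>p. real t *\<^sub>R p) ` P \<inter> lattice_points. real_action (\<rho> g) x = x})
     else 0)"

text \<open>
  Power series over the ring of complex functions on \<open>G\<close>, with pointwise operations on the
  coefficients.
\<close>

definition equivariant_ehrhart_series ::
    "('g, 'b) monoid_scheme \<Rightarrow> ('g \<Rightarrow> int ^ 'm ^ 'm) \<Rightarrow> (real ^ 'm) set \<Rightarrow> ('g \<Rightarrow> complex) fps" where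
  "equivariant_ehrhart_series G \<rho> P = Abs_fps (ehrhart_character G \<rho> P)"

definition det_one_minus_z :: "int ^ 'm ^ 'm \<Rightarrow> complex fps" where
  "det_one_minus_z A =
     Determinants.det (Finite_Cartesian_Product.mat 1
       - map_matrix (\<lambda>a. fps_X * of_int a) A)"

definition det_series ::
    "('g, 'b) monoid_scheme \<Rightarrow> ('g \<Rightarrow> int ^ 'm ^ 'm) \<Rightarrow> ('g \<Rightarrow> complex) fps" where
  "det_series G \<rho> =
     Abs_fps (\<lambda>i g. if g \<in> carrier G then fps_nth (det_one_minus_z (\<rho> g)) i else 0)"

text \<open>
  The equation \<open>\<Sum>t. \<chi>\<^sub>t\<^sub>P z^t = H* / det(I - z \<rho>)\<close>, solved for \<open>H*\<close>; the denominator has constant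
  term 1 on \<open>G\<close> and is therefore a unit among the power series supported on \<open>G\<close>.
\<close>

definition H_star ::
    "('g, 'b) monoid_scheme \<Rightarrow> ('g \<Rightarrow> int ^ 'm ^ 'm) \<Rightarrow> (real ^ 'm) set \<Rightarrow> ('g \<Rightarrow> complex) fps" where
  "H_star G \<rho> P = equivariant_ehrhart_series G \<rho> P * det_series G \<rho>"

definition is_polynomial_over_character_ring ::
    "('g, 'b) monoid_scheme \<Rightarrow> ('g \<Rightarrow> complex) fps \<Rightarrow> bool" where
  "is_polynomial_over_character_ring G F \<longleftrightarrow>
     (\<exists>p. (\<forall>i. Polynomial.coeff p i \<in> character_ring G) \<and> F = fps_of_poly p)"

end

theory Submission
  imports Defs
begin

text \<open>
  Each coefficient of the \<open>H*\<close>-series at \<open>g\<close> depends only on the fixed lattice points and the matrix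
  of \<open>g\<close>, so the series for the subgroup is the coefficientwise restriction of the series for \<open>G\<close>.
  It remains to see that restriction maps the character ring of \<open>G\<close> into that of the subgroup,
  that is, that the character of an arbitrary representation is a sum of irreducible characters.
  By induction on the degree this needs only an invariant subspace: in an adapted basis the
  representation is block triangular, and its trace is the sum of the traces of the two diagonal
  blocks. Complete reducibility is not used.
\<close>

section \<open>Linear algebra: adapted bases and the trace\<close>

context vec_space
begin

text \<open>Independent sets have at most \<open>dim\<close> elements, so a maximal independent set
  between \<open>A\<close> and \<open>W\<close> exists; a vector of \<open>W\<close> outside its
  span could still be added to it.\<close>

lemma lin_indpt_extend_to_subspace:
  assumes W: "VectorSpace.subspace class_ring W V" and A: "A \<subseteq> W" "lin_indpt A"
  shows "\<exists>B. finite B \<and> A \<subseteq> B \<and> B \<subseteq> W \<and> lin_indpt B \<and> span B = W"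
proof -
  have sub: "submodule class_ring W V" and WV: "W \<subseteq> carrier_vec n"
    using W by (auto simp: subspace_def submodule_def)
  let ?P = "\<lambda>S. A \<subseteq> S \<and> S \<subseteq> W \<and> lin_indpt S"
  obtain B where "finite B" and max: "maximal B ?P"
  proof -
    have "finite S \<and> card S \<le> dim" if "?P S" for S
      using that WV li_le_dim[of S] by auto
    moreover have "?P A" using A by auto
    ultimately show thesis using maximal_exists[of ?P dim A] that by blast
  qed
  then have B: "A \<subseteq> B" "B \<subseteq> W" "lin_indpt B" by (auto simp: maximal_def)
  have "span B = W"
  proof
    show "span B \<subseteq> W" using span_is_subset[OF B(2) sub] .
    show "W \<subseteq> span B"
    proof
      fix v assume v: "v \<in> W"
      show "v \<in> span B"
      proof (rule ccontr)
        assume nin: "v \<notin> span B"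
        have vB: "v \<notin> B" using nin in_own_span[of B] B WV by auto
        have "?P (B \<union> {v})"
          using lin_dep_iff_in_span[of B v] B v vB nin WV by auto
        then show False using max vB unfolding maximal_def by blast
      qed
    qed
  qed
  then show ?thesis using \<open>finite B\<close> B by blast
qed

text \<open>The columns of \<open>Q\<close> are a basis of \<open>W\<close> followed by vectors
  completing it to a basis of the whole space, and \<open>R\<close> reads off coordinates in that
  basis. Membership in \<open>W\<close> thus becomes the vanishing of all coordinates from
  \<open>k\<close> on, which is what makes an invariant subspace visible as a block of
  zeros.\<close>

lemma subspace_adapted_basis:
  assumes W: "VectorSpace.subspace class_ring W V"
  obtains Q R k where "Q \<in> carrier_mat n n" "R \<in> carrier_mat n n"
    "Q * R = 1\<^sub>m n" "R * Q = 1\<^sub>m n" "k \<le> n"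
    "W = {Q *\<^sub>v u | u. u \<in> carrier_vec n \<and> (\<forall>i. k \<le> i \<and> i < n \<longrightarrow> vec_index u i = 0)}"
proof -
  have WV: "W \<subseteq> carrier_vec n" using W by (auto simp: subspace_def submodule_def)
  have full: "VectorSpace.subspace class_ring (carrier_vec n) V"
    using span_is_subspace[of "set (unit_vecs n)"] span_unit_vecs_is_carrier
    by (simp add: unit_vecs_carrier)
  \<comment> \<open>The extension lemma is applied twice: from the empty set to a basis
    \<open>A\<close> of \<open>W\<close>, then from \<open>A\<close> to a basis \<open>B\<close> of
    the whole space.\<close>
  have "lin_indpt {}" by (auto simp: lin_dep_def)
  then obtain A where A: "finite A" "A \<subseteq> W" "lin_indpt A" "span A = W"
    using lin_indpt_extend_to_subspace[OF W, of "{}"] by auto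
  obtain B where B: "finite B" "A \<subseteq> B" "B \<subseteq> carrier_vec n" "lin_indpt B" "span B = carrier_vec n"
    using lin_indpt_extend_to_subspace[OF full, of A] A WV by auto
  have cardB: "card B = n"
    using dim_basis[of B] B dim_is_n by (auto simp: basis_def)
  \<comment> \<open>The order of the list matters: the vectors of \<open>W\<close> come first, so
    they occupy the columns below \<open>?k\<close>.\<close>
  obtain ws where ws: "set ws = A" "distinct ws" using A finite_distinct_list by blast
  obtain us where us: "set us = B - A" "distinct us" using B finite_distinct_list[of "B - A"] by blast
  let ?bs = "ws @ us" let ?k = "length ws"
  define Q where "Q = mat_of_cols n ?bs"
  have set: "set ?bs = B" using ws us B by auto
  have "distinct ?bs" using ws us by auto
  then have len: "length ?bs = n" using cardB set distinct_card[of ?bs] by simp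
  have Q: "Q \<in> carrier_mat n n" unfolding Q_def using len by (metis mat_of_cols_carrier(1))
  have k: "?k \<le> n" using len by simp
  \<comment> \<open>Since the columns of \<open>Q\<close> span the space, each unit vector can be
    solved for; the solutions are the columns of \<open>R\<close>.\<close>
  have "\<exists>c. c \<in> carrier_vec n \<and> Q *\<^sub>v c = unit_vec n j" if "j < n" for j
  proof -
    have "unit_vec n j \<in> span_list ?bs"
      using span_list_as_span[of ?bs, unfolded set] B(3,5) by simp
    then obtain c where "unit_vec n j = lincomb_list c ?bs" by (rule in_span_listE)
    also have "\<dots> = Q *\<^sub>v Matrix.vec n c"
      unfolding Q_def using lincomb_list_as_mat_mult[of ?bs c] set B len
      by (metis carrier_vecD subsetD)
    finally show ?thesis by (metis vec_carrier)
  qed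
  then obtain c where c: "\<And>j. j < n \<Longrightarrow> c j \<in> carrier_vec n \<and> Q *\<^sub>v c j = unit_vec n j"
    by metis
  define R where "R = mat_of_cols n (map c [0..<n])"
  have R: "R \<in> carrier_mat n n" unfolding R_def using mat_of_cols_carrier(1)[of n "map c [0..<n]"] by simp
  have colR: "col R j = c j" if "j < n" for j
    unfolding R_def using that c by (subst col_mat_of_cols) auto
  have QR: "Q * R = 1\<^sub>m n"
  proof (rule mat_col_eqI)
    fix j assume "j < dim_col (1\<^sub>m n :: 'a mat)"
    then have j: "j < n" by simp
    have "col (Q * R) j = Q *\<^sub>v col R j" using Q R j by (intro eq_vecI) auto
    then show "col (Q * R) j = col (1\<^sub>m n) j" using c[OF j] colR[OF j] j by simp
  qed (use Q R in auto)
  have RQ: "R * Q = 1\<^sub>m n" using mat_mult_left_right_inverse[OF Q R QR] .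
  \<comment> \<open>Padding the coefficients with zeros turns a combination of \<open>ws\<close>
    alone into \<open>Q\<close> applied to a vector supported below \<open>?k\<close>.\<close>
  have pad: "lincomb_list f ws = Q *\<^sub>v Matrix.vec n (\<lambda>i. if i < ?k then f i else 0)" for f
  proof (rule eq_vecI)
    have f: "lincomb_list f ws = mat_of_cols n ws *\<^sub>v Matrix.vec ?k f"
      using lincomb_list_as_mat_mult[of ws f] ws A WV by (metis carrier_vecD subsetD)
    show "dim_vec (lincomb_list f ws) = dim_vec (Q *\<^sub>v Matrix.vec n (\<lambda>i. if i < ?k then f i else 0))"
      unfolding f using Q by simp
    fix i assume "i < dim_vec (Q *\<^sub>v Matrix.vec n (\<lambda>i. if i < ?k then f i else 0))"
    then have i: "i < n" using Q by simp
    have "vec_index (lincomb_list f ws) i = (\<Sum>j\<in>{0..<?k}. vec_index (ws ! j) i * f j)"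
      unfolding f using i by (simp add: scalar_prod_def mat_of_cols_index)
    also have "\<dots> = (\<Sum>j\<in>{0..<n}. vec_index (?bs ! j) i * (if j < ?k then f j else 0))"
      using k by (intro sum.mono_neutral_cong_left) (auto simp: nth_append)
    also have "\<dots> = vec_index (Q *\<^sub>v Matrix.vec n (\<lambda>i. if i < ?k then f i else 0)) i"
      unfolding Q_def using i len by (simp add: scalar_prod_def mat_of_cols_index)
    finally show "vec_index (lincomb_list f ws) i
      = vec_index (Q *\<^sub>v Matrix.vec n (\<lambda>i. if i < ?k then f i else 0)) i" .
  qed
  have Wl: "W = {lincomb_list f ws | f. True}"
    using span_list_as_span[of ws] A ws WV by (auto simp: span_list_def)
  have "W = {Q *\<^sub>v u | u. u \<in> carrier_vec n \<and> (\<forall>i. ?k \<le> i \<and> i < n \<longrightarrow> vec_index u i = 0)}"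
    (is "_ = ?rhs")
  proof (intro equalityI subsetI)
    fix w assume "w \<in> W"
    then obtain f where "w = lincomb_list f ws" using Wl by auto
    then show "w \<in> ?rhs" unfolding pad by auto
  next
    fix w assume "w \<in> ?rhs"
    then obtain u where u: "w = Q *\<^sub>v u" "u \<in> carrier_vec n"
      "\<And>i. ?k \<le> i \<Longrightarrow> i < n \<Longrightarrow> vec_index u i = 0" by auto
    \<comment> \<open>This puts \<open>u\<close> into the padded form, so that \<open>pad\<close>
      can be read from right to left.\<close>
    have "u = Matrix.vec n (\<lambda>i. if i < ?k then vec_index u i else 0)"
      using u by (intro eq_vecI) auto
    then have "w = lincomb_list (vec_index u) ws" unfolding pad using u(1) by metis
    then show "w \<in> W" using Wl by auto
  qed
  then show thesis using that[OF Q R QR RQ k] by simp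
qed

end

text \<open>Cyclicity of the trace, by exchanging the two summations; the trace is spelled out as in
  \<open>rep_character\<close>. It makes characters invariant under change of basis.\<close>

lemma sum_diag_mult_commute:
  fixes A B :: "'a :: comm_semiring_0 mat"
  assumes A: "A \<in> carrier_mat n m" and B: "B \<in> carrier_mat m n"
  shows "(\<Sum>i<n. (A * B) $$ (i, i)) = (\<Sum>i<m. (B * A) $$ (i, i))"
proof -
  have "(\<Sum>i<n. (A * B) $$ (i, i)) = (\<Sum>i<n. \<Sum>j<m. A $$ (i, j) * B $$ (j, i))"
    using A B by (intro sum.cong) (auto simp: scalar_prod_def lessThan_atLeast0)
  also have "\<dots> = (\<Sum>j<m. \<Sum>i<n. B $$ (j, i) * A $$ (i, j))"
    by (subst sum.swap) (simp add: mult.commute)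
  also have "\<dots> = (\<Sum>i<m. (B * A) $$ (i, i))"
    using A B by (intro sum.cong) (auto simp: scalar_prod_def lessThan_atLeast0)
  finally show ?thesis .
qed

section \<open>Additive structure of the character ring\<close>

lemma character_ring_0: "(\<lambda>g. 0) \<in> character_ring G"
  unfolding character_ring_def by (intro CollectI exI[of _ "{}"]) auto

lemma irreducible_in_character_ring:
  "\<psi> \<in> irreducible_characters G \<Longrightarrow> \<psi> \<in> character_ring G"
  unfolding character_ring_def by (intro CollectI exI[of _ "{\<psi>}"] exI[of _ "\<lambda>_. 1"]) auto

lemma character_ring_add:
  assumes "f \<in> character_ring G" "h \<in> character_ring G"
  shows "(\<lambda>g. f g + h g) \<in> character_ring G"
proof -
  obtain S a where S: "f = (\<lambda>g. \<Sum>\<psi>\<in>S. of_int (a \<psi> :: int) * \<psi> g)"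
    "finite S" "S \<subseteq> irreducible_characters G"
    using assms(1) unfolding character_ring_def by auto
  obtain T b where T: "h = (\<lambda>g. \<Sum>\<psi>\<in>T. of_int (b \<psi> :: int) * \<psi> g)"
    "finite T" "T \<subseteq> irreducible_characters G"
    using assms(2) unfolding character_ring_def by auto
  \<comment> \<open>The two index sets may overlap, so each coefficient function is extended by zero
    to the union before adding.\<close>
  let ?c = "\<lambda>\<psi>. (if \<psi> \<in> S then a \<psi> else 0) + (if \<psi> \<in> T then b \<psi> else 0)"
  have "f g + h g = (\<Sum>\<psi>\<in>S \<union> T. of_int (?c \<psi>) * \<psi> g)" for g
  proof -
    have "f g = (\<Sum>\<psi>\<in>S \<union> T. of_int (if \<psi> \<in> S then a \<psi> else 0) * \<psi> g)"
      unfolding S(1) using S T by (intro sum.mono_neutral_cong_left) auto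
    moreover have "h g = (\<Sum>\<psi>\<in>S \<union> T. of_int (if \<psi> \<in> T then b \<psi> else 0) * \<psi> g)"
      unfolding T(1) using S T by (intro sum.mono_neutral_cong_left) auto
    ultimately show ?thesis
      unfolding of_int_add distrib_right sum.distrib by simp
  qed
  then show ?thesis unfolding character_ring_def
    using S(2,3) T(2,3) by (intro CollectI exI[of _ "S \<union> T"] exI[of _ ?c]) auto
qed

lemma character_ring_scale_int:
  assumes "f \<in> character_ring G"
  shows "(\<lambda>g. of_int k * f g) \<in> character_ring G"
proof -
  obtain S a where S: "f = (\<lambda>g. \<Sum>\<psi>\<in>S. of_int (a \<psi> :: int) * \<psi> g)"
    "finite S" "S \<subseteq> irreducible_characters G"
    using assms unfolding character_ring_def by auto
  then have "(\<lambda>g. of_int k * f g) = (\<lambda>g. \<Sum>\<psi>\<in>S. of_int (k * a \<psi>) * \<psi> g)"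
    by (simp add: sum_distrib_left mult.assoc)
  then show ?thesis unfolding character_ring_def
    using S(2,3) by (intro CollectI exI[of _ S] exI[of _ "\<lambda>\<psi>. k * a \<psi>"]) auto
qed

text \<open>The summands form an indexed family, not a set of characters, because distinct
  irreducible characters can have equal restrictions to a subgroup.\<close>

lemma character_ring_sum:
  assumes "finite S" "\<And>i. i \<in> S \<Longrightarrow> F i \<in> character_ring G"
  shows "(\<lambda>g. \<Sum>i\<in>S. of_int (a i) * F i g) \<in> character_ring G"
  using assms
proof (induction S rule: finite_induct)
  case empty
  then show ?case by (simp add: character_ring_0)
next
  case (insert x S)
  then show ?case
    using character_ring_add[OF character_ring_scale_int[of "F x" G "a x"], of "\<lambda>g. \<Sum>i\<in>S. of_int (a i) * F i g"]
    by simp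
qed

section \<open>Decomposition of an arbitrary character into irreducible ones\<close>

text \<open>When the first \<open>k\<close> basis vectors span an invariant subspace,
  \<open>\<sigma>\<^sub>1\<close> is the action on it and \<open>\<sigma>\<^sub>2\<close> the action
  on the quotient. The diagonal of \<open>\<tau> g\<close> is the union of the diagonals of the two
  blocks.\<close>

lemma block_triangular_sub_quotient:
  fixes \<tau> :: "'g \<Rightarrow> complex mat"
  assumes \<tau>: "complex_rep G n \<tau>" and k: "k \<le> n"
    and tri: "\<And>g i j. g \<in> carrier G \<Longrightarrow> k \<le> i \<Longrightarrow> i < n \<Longrightarrow> j < k \<Longrightarrow> \<tau> g $$ (i, j) = 0"
  defines "\<sigma>\<^sub>1 \<equiv> \<lambda>g. Matrix.mat k k (($$) (\<tau> g))"
    and "\<sigma>\<^sub>2 \<equiv> \<lambda>g. Matrix.mat (n - k) (n - k) (\<lambda>(i, j). \<tau> g $$ (k + i, k + j))"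
  shows "complex_rep G k \<sigma>\<^sub>1" "complex_rep G (n - k) \<sigma>\<^sub>2"
    "rep_character G n \<tau> = (\<lambda>g. rep_character G k \<sigma>\<^sub>1 g + rep_character G (n - k) \<sigma>\<^sub>2 g)"
proof -
  have car: "\<tau> g \<in> carrier_mat n n" if "g \<in> carrier G" for g
    using \<tau> that by (auto simp: complex_rep_def)
  have split: "(\<Sum>l<n. f l) = (\<Sum>l<k. f l) + (\<Sum>l<n - k. f (k + l))" for f :: "nat \<Rightarrow> complex"
  proof -
    have "(\<Sum>l<n. f l) = (\<Sum>l<k. f l) + (\<Sum>l = k..<n. f l)"
      using sum.atLeastLessThan_concat[of 0 k n f] k by (simp add: lessThan_atLeast0)
    also have "(\<Sum>l = k..<n. f l) = (\<Sum>l<n - k. f (k + l))"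
      using sum.shift_bounds_nat_ivl[of f 0 k "n - k"] k by (simp add: lessThan_atLeast0 add.commute)
    finally show ?thesis .
  qed
  \<comment> \<open>Splitting the inner sum at \<open>k\<close> isolates the cross term: in the
    upper left block \<open>tri\<close> kills it through the factor from \<open>h\<close>, in the
    lower right block the other half vanishes through the factor from \<open>g\<close>.\<close>
  have entry: "\<tau> (g \<otimes>\<^bsub>G\<^esub> h) $$ (i, j) =
      (\<Sum>l<k. \<tau> g $$ (i, l) * \<tau> h $$ (l, j)) +
      (\<Sum>l<n - k. \<tau> g $$ (i, k + l) * \<tau> h $$ (k + l, j))"
    if "g \<in> carrier G" "h \<in> carrier G" "i < n" "j < n" for g h i j
  proof -
    have "\<tau> (g \<otimes>\<^bsub>G\<^esub> h) = \<tau> g * \<tau> h" using \<tau> that by (simp add: complex_rep_def)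
    then have "\<tau> (g \<otimes>\<^bsub>G\<^esub> h) $$ (i, j) = (\<Sum>l<n. \<tau> g $$ (i, l) * \<tau> h $$ (l, j))"
      using that carrier_matD[OF car[OF that(1)]] carrier_matD[OF car[OF that(2)]]
      by (simp add: scalar_prod_def lessThan_atLeast0)
    then show ?thesis using split by simp
  qed
  have one: "\<tau> \<one>\<^bsub>G\<^esub> = 1\<^sub>m n" using \<tau> by (simp add: complex_rep_def)
  show "complex_rep G k \<sigma>\<^sub>1"
    unfolding complex_rep_def
  proof (intro conjI ballI)
    show "\<sigma>\<^sub>1 g \<in> carrier_mat k k" for g by (simp add: \<sigma>\<^sub>1_def)
    show "\<sigma>\<^sub>1 \<one>\<^bsub>G\<^esub> = 1\<^sub>m k" using k by (intro eq_matI) (auto simp: \<sigma>\<^sub>1_def one)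
    fix g h assume gh: "g \<in> carrier G" "h \<in> carrier G"
    show "\<sigma>\<^sub>1 (g \<otimes>\<^bsub>G\<^esub> h) = \<sigma>\<^sub>1 g * \<sigma>\<^sub>1 h"
      using k gh by (intro eq_matI)
        (auto simp: \<sigma>\<^sub>1_def entry tri scalar_prod_def lessThan_atLeast0[symmetric])
  qed
  show "complex_rep G (n - k) \<sigma>\<^sub>2"
    unfolding complex_rep_def
  proof (intro conjI ballI)
    show "\<sigma>\<^sub>2 g \<in> carrier_mat (n - k) (n - k)" for g by (simp add: \<sigma>\<^sub>2_def)
    show "\<sigma>\<^sub>2 \<one>\<^bsub>G\<^esub> = 1\<^sub>m (n - k)" using k by (intro eq_matI) (auto simp: \<sigma>\<^sub>2_def one)
    fix g h assume gh: "g \<in> carrier G" "h \<in> carrier G"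
    show "\<sigma>\<^sub>2 (g \<otimes>\<^bsub>G\<^esub> h) = \<sigma>\<^sub>2 g * \<sigma>\<^sub>2 h"
      using k gh by (intro eq_matI)
        (auto simp: \<sigma>\<^sub>2_def entry tri scalar_prod_def lessThan_atLeast0[symmetric])
  qed
  show "rep_character G n \<tau> = (\<lambda>g. rep_character G k \<sigma>\<^sub>1 g + rep_character G (n - k) \<sigma>\<^sub>2 g)"
    by (rule ext) (simp add: rep_character_def split[of "\<lambda>i. \<tau> _ $$ (i, i)"] \<sigma>\<^sub>1_def \<sigma>\<^sub>2_def)
qed

text \<open>\<open>Q * R\<close> cancels between two factors and, after a cyclic shift, inside the
  trace; \<open>R * Q\<close> gives the value at the unit.\<close>

lemma complex_rep_conjugate:
  assumes \<sigma>: "complex_rep G n \<sigma>" and Q: "Q \<in> carrier_mat n n" and R: "R \<in> carrier_mat n n"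
    and inv: "Q * R = 1\<^sub>m n" "R * Q = 1\<^sub>m n"
  shows "complex_rep G n (\<lambda>g. R * \<sigma> g * Q)"
    "rep_character G n (\<lambda>g. R * \<sigma> g * Q) = rep_character G n \<sigma>"
proof -
  have car: "\<sigma> g \<in> carrier_mat n n" if "g \<in> carrier G" for g
    using \<sigma> that by (auto simp: complex_rep_def)
  show "complex_rep G n (\<lambda>g. R * \<sigma> g * Q)"
    unfolding complex_rep_def
  proof (intro conjI ballI)
    fix g assume g: "g \<in> carrier G"
    show "R * \<sigma> g * Q \<in> carrier_mat n n" using car[OF g] Q R by simp
    fix h assume h: "h \<in> carrier G"
    have "R * \<sigma> g * Q * (R * \<sigma> h * Q) = R * \<sigma> g * (Q * (R * (\<sigma> h * Q)))"
      using Q R car[OF g] car[OF h] by (simp add: assoc_mult_mat[of _ n n _ n _ n])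
    also have "\<dots> = R * \<sigma> g * (Q * R * (\<sigma> h * Q))"
      using Q R car[OF h] by (simp add: assoc_mult_mat[of _ n n _ n _ n])
    also have "\<dots> = R * (\<sigma> g * \<sigma> h) * Q"
      unfolding inv using Q R car[OF g] car[OF h] by (simp add: assoc_mult_mat[of _ n n _ n _ n])
    finally show "R * \<sigma> (g \<otimes>\<^bsub>G\<^esub> h) * Q = R * \<sigma> g * Q * (R * \<sigma> h * Q)"
      using \<sigma> g h by (simp add: complex_rep_def)
  qed (use \<sigma> Q R inv in \<open>auto simp: complex_rep_def\<close>)
  have "(\<Sum>i<n. (R * \<sigma> g * Q) $$ (i, i)) = (\<Sum>i<n. \<sigma> g $$ (i, i))" if g: "g \<in> carrier G" for g
  proof -
    have "(\<Sum>i<n. (R * \<sigma> g * Q) $$ (i, i)) = (\<Sum>i<n. (Q * (R * \<sigma> g)) $$ (i, i))"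
      using Q R car[OF g] by (intro sum_diag_mult_commute) auto
    also have "Q * (R * \<sigma> g) = Q * R * \<sigma> g"
      using Q R car[OF g] by (simp add: assoc_mult_mat[of _ n n _ n _ n])
    finally show ?thesis using inv car[OF g] by simp
  qed
  then show "rep_character G n (\<lambda>g. R * \<sigma> g * Q) = rep_character G n \<sigma>"
    by (auto simp: rep_character_def)
qed

text \<open>Strong induction on the degree: a reducible representation is conjugated into block
  triangular form, and both blocks have smaller degree.\<close>

lemma rep_character_in_character_ring:
  "complex_rep G n \<sigma> \<Longrightarrow> rep_character G n \<sigma> \<in> character_ring G"
proof (induction n arbitrary: \<sigma> rule: less_induct)
  case (less n)
  note \<sigma> = less.prems
  \<comment> \<open>Degree 0 stands apart because \<open>irreducible_rep\<close> requires positive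
    degree; its character is an empty sum.\<close>
  consider "n = 0" | "irreducible_rep G n \<sigma>" | "n > 0" "\<not> irreducible_rep G n \<sigma>" by auto
  then show ?case
  proof cases
    case 1
    then have "rep_character G n \<sigma> = (\<lambda>g. 0)" by (auto simp: rep_character_def)
    then show ?thesis by (simp add: character_ring_0)
  next
    case 2
    then show ?thesis
      by (intro irreducible_in_character_ring) (auto simp: irreducible_characters_def)
  next
    case 3
    interpret vec_space "TYPE(complex)" n .
    have car: "\<sigma> g \<in> carrier_mat n n" if "g \<in> carrier G" for g
      using \<sigma> that by (auto simp: complex_rep_def)
    obtain W where W: "VectorSpace.subspace class_ring W (module_vec TYPE(complex) n)"
      and stable: "\<And>g w. g \<in> carrier G \<Longrightarrow> w \<in> W \<Longrightarrow> \<sigma> g *\<^sub>v w \<in> W"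
      and nt: "W \<noteq> {0\<^sub>v n}" "W \<noteq> carrier_vec n"
      using 3 \<sigma> unfolding irreducible_rep_def by blast
    obtain Q R k where Q: "Q \<in> carrier_mat n n" and R: "R \<in> carrier_mat n n"
      and QR: "Q * R = 1\<^sub>m n" and RQ: "R * Q = 1\<^sub>m n" and k: "k \<le> n"
      and Weq: "W = {Q *\<^sub>v u | u. u \<in> carrier_vec n \<and> (\<forall>i. k \<le> i \<and> i < n \<longrightarrow> vec_index u i = 0)}"
      by (rule subspace_adapted_basis[OF W])
    \<comment> \<open>Since \<open>W\<close> is neither zero nor everything, \<open>k\<close> lies
      strictly between 0 and \<open>n\<close>, so the induction hypothesis will apply to the degrees
      \<open>k\<close> and \<open>n - k\<close>.\<close>
    have "k \<noteq> 0"
    proof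
      assume "k = 0"
      then have "{u. u \<in> carrier_vec n \<and> (\<forall>i. k \<le> i \<and> i < n \<longrightarrow> vec_index u i = 0)} = {0\<^sub>v n :: complex vec}"
        by auto
      then have "W = (*\<^sub>v) Q ` {0\<^sub>v n}" unfolding Weq by blast
      also have "\<dots> = {0\<^sub>v n}" using Q by auto
      finally have "W = {0\<^sub>v n}" .
      then show False using nt by simp
    qed
    have "k \<noteq> n"
    proof
      assume "k = n"
      then have W': "W = {Q *\<^sub>v u | u. u \<in> carrier_vec n}" unfolding Weq by auto
      have "v = Q *\<^sub>v (R *\<^sub>v v)" if "v \<in> carrier_vec n" for v
        using assoc_mult_mat_vec[OF Q R that] that by (simp add: QR)
      then have "W = carrier_vec n"
        unfolding W' using Q R by (auto intro: mult_mat_vec_carrier)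
      then show False using nt by simp
    qed
    define \<tau> where "\<tau> = (\<lambda>g. R * \<sigma> g * Q)"
    note conj = complex_rep_conjugate[OF \<sigma> Q R QR RQ, folded \<tau>_def]
    \<comment> \<open>Column \<open>j\<close> of \<open>\<tau> g\<close> is computed by following a
      unit vector: \<open>Q\<close> sends it into \<open>W\<close>, \<open>\<sigma> g\<close> keeps
      it there, and \<open>R\<close> returns coordinates that vanish from \<open>k\<close>
      on.\<close>
    have tri: "\<tau> g $$ (i, j) = 0" if g: "g \<in> carrier G" and i: "k \<le> i" "i < n" and j: "j < k" for g i j
    proof -
      have jn: "j < n" using j k by simp
      have "Q *\<^sub>v unit_vec n j \<in> W"
        unfolding Weq using j jn by (auto intro!: exI[of _ "unit_vec n j"])
      then obtain u where u: "\<sigma> g *\<^sub>v (Q *\<^sub>v unit_vec n j) = Q *\<^sub>v u" "u \<in> carrier_vec n"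
        "\<forall>i. k \<le> i \<and> i < n \<longrightarrow> vec_index u i = 0"
        using stable[OF g] unfolding Weq by blast
      have "\<tau> g *\<^sub>v unit_vec n j = R *\<^sub>v (\<sigma> g *\<^sub>v (Q *\<^sub>v unit_vec n j))"
        unfolding \<tau>_def using Q R car[OF g]
        by (simp add: assoc_mult_mat_vec[of _ n n _ n])
      also have "\<dots> = R * Q *\<^sub>v u"
        unfolding u(1) using Q R u(2) by (simp add: assoc_mult_mat_vec[of _ n n _ n])
      also have "\<dots> = u" using u(2) by (simp add: RQ)
      finally have "\<tau> g *\<^sub>v unit_vec n j = u" .
      moreover have "\<tau> g \<in> carrier_mat n n" using conj(1) g by (simp add: complex_rep_def)
      ultimately show ?thesis using u(3) i jn by auto
    qed
    obtain \<sigma>\<^sub>1 \<sigma>\<^sub>2 where "complex_rep G k \<sigma>\<^sub>1" "complex_rep G (n - k) \<sigma>\<^sub>2"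
      and sum: "rep_character G n \<tau> = (\<lambda>g. rep_character G k \<sigma>\<^sub>1 g + rep_character G (n - k) \<sigma>\<^sub>2 g)"
      using block_triangular_sub_quotient[of G n \<tau> k] conj(1) k tri by blast
    then have "rep_character G n \<tau> \<in> character_ring G"
      unfolding sum using \<open>k \<noteq> 0\<close> \<open>k \<noteq> n\<close> k by (intro character_ring_add less.IH) auto
    then show ?thesis using conj(2) by simp
  qed
qed

section \<open>Restriction to the subgroup\<close>

lemma rep_character_restrict:
  assumes "complex_rep G n \<sigma>" "\<H> \<subseteq> carrier G"
  shows "complex_rep (G\<lparr>carrier := \<H>\<rparr>) n \<sigma>"
    "(\<lambda>g. if g \<in> \<H> then rep_character G n \<sigma> g else 0) = rep_character (G\<lparr>carrier := \<H>\<rparr>) n \<sigma>"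
proof -
  show "complex_rep (G\<lparr>carrier := \<H>\<rparr>) n \<sigma>"
    using assms by (auto simp: complex_rep_def)
  show "(\<lambda>g. if g \<in> \<H> then rep_character G n \<sigma> g else 0) = rep_character (G\<lparr>carrier := \<H>\<rparr>) n \<sigma>"
    using assms(2) by (intro ext) (auto simp: rep_character_def)
qed

text \<open>An irreducible representation of \<open>G\<close> may become reducible on
  \<open>\<H>\<close>, so its restricted character is first recognized as the character of some
  representation and then decomposed. The value 0 off \<open>\<H>\<close> follows the convention for
  class functions.\<close>

lemma character_ring_restrict:
  assumes f: "f \<in> character_ring G" and H: "\<H> \<subseteq> carrier G"
  shows "(\<lambda>g. if g \<in> \<H> then f g else 0) \<in> character_ring (G\<lparr>carrier := \<H>\<rparr>)"
proof -
  obtain S a where S: "f = (\<lambda>g. \<Sum>\<psi>\<in>S. of_int (a \<psi> :: int) * \<psi> g)"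
    "finite S" "S \<subseteq> irreducible_characters G"
    using f unfolding character_ring_def by auto
  have "(\<lambda>g. if g \<in> \<H> then \<psi> g else 0) \<in> character_ring (G\<lparr>carrier := \<H>\<rparr>)" if \<psi>: "\<psi> \<in> S" for \<psi>
  proof -
    obtain n \<sigma> where "complex_rep G n \<sigma>" "\<psi> = rep_character G n \<sigma>"
      using subsetD[OF S(3) \<psi>] by (auto simp: irreducible_characters_def irreducible_rep_def)
    then show ?thesis
      using rep_character_restrict[OF _ H] rep_character_in_character_ring by metis
  qed
  then have "(\<lambda>g. \<Sum>\<psi>\<in>S. of_int (a \<psi>) * (if g \<in> \<H> then \<psi> g else 0)) \<in> character_ring (G\<lparr>carrier := \<H>\<rparr>)"
    by (intro character_ring_sum S(2))
  also have "(\<lambda>g. \<Sum>\<psi>\<in>S. of_int (a \<psi>) * (if g \<in> \<H> then \<psi> g else 0)) = (\<lambda>g. if g \<in> \<H> then f g else 0)"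
    by (auto simp: S(1))
  finally show ?thesis .
qed

lemma fun_sum_apply: "(\<Sum>i\<in>S. F i) x = (\<Sum>i\<in>S. F i x)"
  by (induction S rule: infinite_finite_induct) auto

text \<open>The Cauchy product is computed separately at each \<open>g\<close>, and both factors at
  \<open>g\<close> depend only on \<open>\<rho> g\<close> and \<open>P\<close>; off
  \<open>\<H>\<close> both vanish.\<close>

lemma H_star_restrict:
  assumes "\<H> \<subseteq> carrier G"
  shows "fps_nth (H_star (G\<lparr>carrier := \<H>\<rparr>) \<rho> P) i g
    = (if g \<in> \<H> then fps_nth (H_star G \<rho> P) i g else 0)"
  using assms
  by (auto simp: H_star_def fps_mult_nth fun_sum_apply equivariant_ehrhart_series_def
      det_series_def ehrhart_character_def intro!: sum.cong)

theorem theorem2p13: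
  fixes G :: "('g, 'b) monoid_scheme"
    and \<H> :: "'g set"
    and \<rho> :: "'g \<Rightarrow> int ^ 'm ^ 'm"
    and c :: 'm
    and d :: nat
    and P :: "(real ^ 'm) set"
  assumes "group G"
    and "finite (carrier G)"
    and "CARD('m) = d + 1"
    and "\<rho> \<in> hom G lattice_GL"
    and "\<And>g v. g \<in> carrier G \<Longrightarrow>
           (\<rho> g *v v) $ c = v $ c"
    and "polytope P"
    and "aff_dim P = int d"
    and "\<And>x. x extreme_point_of P \<Longrightarrow>
           x \<in> lattice_points \<and> x $ c = 1"
    and "\<And>g. g \<in> carrier G \<Longrightarrow> real_action (\<rho> g) ` P = P"
    and "subgroup \<H> G"
    and "is_polynomial_over_character_ring G (H_star G \<rho> P)"
  shows "is_polynomial_over_character_ring (G\<lparr>carrier := \<H>\<rparr>) (H_star (G\<lparr>carrier := \<H>\<rparr>) \<rho> P)"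
proof -
  have H: "\<H> \<subseteq> carrier G" using \<open>subgroup \<H> G\<close> by (rule subgroup.subset)
  obtain p where p: "\<And>i. Polynomial.coeff p i \<in> character_ring G" "H_star G \<rho> P = fps_of_poly p"
    using assms(11) by (auto simp: is_polynomial_over_character_ring_def)
  define res :: "('g \<Rightarrow> complex) \<Rightarrow> 'g \<Rightarrow> complex" where "res f = (\<lambda>g. if g \<in> \<H> then f g else 0)" for f
  \<comment> \<open>Preservation of 0 is what lets \<open>map_poly res\<close> act coefficient by
    coefficient, including beyond the degree of \<open>p\<close>.\<close>
  have res0: "res 0 = 0" by (auto simp: res_def)
  have "Polynomial.coeff (map_poly res p) i \<in> character_ring (G\<lparr>carrier := \<H>\<rparr>)" for i
    using character_ring_restrict[OF p(1) H] by (simp add: coeff_map_poly res0) (simp add: res_def)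
  moreover have "H_star (G\<lparr>carrier := \<H>\<rparr>) \<rho> P = fps_of_poly (map_poly res p)"
    by (rule fps_ext, rule ext)
      (simp add: H_star_restrict[OF H] p(2) coeff_map_poly res0, simp add: res_def)
  ultimately show ?thesis by (auto simp: is_polynomial_over_character_ring_def)
qed

end
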